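(* For all natural numbers $n > m \geq 0$ and $0 \leq t \leq m+1$, \[ r^t_{n,m} = r^t_{n,m-1} + \sum_{k=1}^{n-m-1} r^t_{n-k,m-1} \binom{r^{t-1}_{m,m-1}}{k} + \binom{r^{t-1}_{m,m-1}}{n-m} \sum_{k=0}^m r^t_{k,k-1}, \] where $r^t_{0,-1} = 1$ and $r^t_{n,-1} = 0$ for all $n \geq 1$ and $t \geq 0$, and where $\binom{a}{b} = 0$ if $a < b$.
   Context: The adjunctive hierarchy of hereditarily finite sets is defined by $A_0 := \{\emptyset\}$ and $A_{n+1} := \{\emptyset\} \cup \{ x \cup \{y\} : x, y \in A_n\}$, with the convention $A_n := \emptyset$ for integers $n<0$. The (von Neumann) rank is $\mathsf{rk}(\emptyset) = 0$ and $\mathsf{rk}(x) = \max\{\mathsf{rk}(y) : y \in x\} + 1$ for $x \neq \emptyset$. For integers $n, m, t$, let $R^t_{n,m} := \{ x \in A_n \setminus A_{n-1} : x \subseteq A_m \text{ and } \mathsf{rk}(x) \leq t\}$ and $r^t_{n,m} := |R^t_{n,m}|$ (so $r^{t}_{n,m} = 0$ when $t < 0$). *)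

theory Defs
  imports Main "HOL-Library.FSet"
begin

datatype hf = HF (elts: "hf fset")

definition hempty :: hf
  where "hempty = HF {||}"

text \<open>The set \<open>x \<union> {y}\<close>.\<close>
definition adjoin :: "hf \<Rightarrow> hf \<Rightarrow> hf"
  where "adjoin x y = HF (elts x |\<union>| {|y|})"

primrec rk :: "hf \<Rightarrow> nat"
  where "rk (HF X) = (if X = {||} then 0 else fMax (rk |`| X) + 1)"

primrec adj_nat :: "nat \<Rightarrow> hf set"
  where
    "adj_nat 0 = {hempty}"
  | "adj_nat (Suc n) = {hempty} \<union> {adjoin x y |x y. x \<in> adj_nat n \<and> y \<in> adj_nat n}"

text \<open>Levels and parameters are integers, since index \<open>-1\<close> is used throughout.\<close>
definition adj :: "int \<Rightarrow> hf set"
  where "adj n = (if n < 0 then {} else adj_nat (nat n))"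

definition R :: "int \<Rightarrow> int \<Rightarrow> int \<Rightarrow> hf set"
  where "R t n m = {x \<in> adj n - adj (n - 1). fset (elts x) \<subseteq> adj m \<and> int (rk x) \<le> t}"

definition r :: "int \<Rightarrow> int \<Rightarrow> int \<Rightarrow> nat"
  where "r t n m = card (R t n m)"

lemma rk_hempty: "rk hempty = 0"
  by (simp add: hempty_def)

lemma rk_nonempty:
  assumes "x \<noteq> hempty"
  shows "rk x = Max (rk ` fset (elts x)) + 1"
  using assms by (cases x) (auto simp: hempty_def fMax.F.rep_eq)

lemma finite_adj: "finite (adj n)"
proof -
  have "finite (adj_nat k)" for k
    by (induction k) (auto intro: finite_image_set2)
  then show ?thesis
    by (simp add: adj_def)
qed

lemma finite_R: "finite (R t n m)"
  unfolding R_def using finite_adj[of n] by auto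

lemma r_neg_rank: "t < 0 \<Longrightarrow> r t n m = 0"
  by (simp add: r_def R_def)

text \<open>The initial values at \<open>m = -1\<close> follow from \<open>adj (-1) = {}\<close>.\<close>

lemma hempty_in_adj: "0 \<le> n \<Longrightarrow> hempty \<in> adj n"
  by (cases "nat n") (auto simp: adj_def)

lemma r_0_minus_1:
  assumes "0 \<le> t"
  shows "r t 0 (-1) = 1"
proof -
  have "R t 0 (-1) = {hempty}"
    using assms by (auto simp: R_def adj_def hempty_def)
  then show ?thesis
    by (simp add: r_def)
qed

lemma r_pos_minus_1:
  assumes "1 \<le> n"
  shows "r t n (-1) = 0"
proof -
  have "x = hempty" if "fset (elts x) \<subseteq> {}" for x
    using that by (cases x) (auto simp: hempty_def)
  then have "R t n (-1) = {}"
    using hempty_in_adj[of "n - 1"] assms by (fastforce simp: R_def adj_def[of "-1"])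
  then show ?thesis
    by (simp add: r_def)
qed

end

theory Submission
  imports Defs
begin

text \<open>
  Let the level of a set be the least \<open>n\<close> with the set in \<open>A\<^sub>n\<close>. An element of maximal level can
  always be adjoined last, so if \<open>x\<close> is the union of \<open>X \<subseteq> A\<^bsub>m-1\<^esub>\<close> and a set \<open>Z\<close> of \<open>k \<ge> 1\<close> elements of
  level exactly \<open>m\<close>, then \<open>x\<close> has level \<open>max (level X) m + k\<close>. The recurrence counts the pairs
  \<open>(X, Z)\<close> by \<open>k\<close>: for \<open>k < n - m\<close> the level of \<open>X\<close> must be \<open>n - k\<close> exactly, whereas for
  \<open>k = n - m\<close> it can be anything up to \<open>m\<close>.
\<close>

section \<open>Levels of the adjunctive hierarchy\<close>

lemma adj_nat_Suc_subset: "adj_nat n \<subseteq> adj_nat (Suc n)"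
proof (induction n)
  case (Suc n)
  show ?case
  proof
    fix x assume "x \<in> adj_nat (Suc n)"
    then consider "x = hempty" | u v where "x = adjoin u v" "u \<in> adj_nat n" "v \<in> adj_nat n"
      by auto
    then show "x \<in> adj_nat (Suc (Suc n))"
    proof cases
      case 1
      then show ?thesis by simp
    next
      case 2
      with Suc.IH have "u \<in> adj_nat (Suc n)" "v \<in> adj_nat (Suc n)" by blast+
      with 2(1) show ?thesis unfolding adj_nat.simps(2)[of "Suc n"] by blast
    qed
  qed
qed simp

lemma adj_nat_elts: "x \<in> adj_nat (Suc n) \<Longrightarrow> y |\<in>| elts x \<Longrightarrow> y \<in> adj_nat n"
proof (induction n arbitrary: x)
  case 0
  then show ?case by (auto simp: adjoin_def hempty_def)
next
  case (Suc n)
  then obtain u v where uv: "x = adjoin u v" "u \<in> adj_nat (Suc n)" "v \<in> adj_nat (Suc n)"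
    unfolding adj_nat.simps(2)[of "Suc n"] by (auto simp: hempty_def)
  then consider "y = v" | "y |\<in>| elts u"
    using Suc.prems(2) by (auto simp: adjoin_def)
  then show ?case
    using uv Suc.IH[of u] adj_nat_Suc_subset[of n] by cases auto
qed

text \<open>Induction on the last adjunction \<open>adjoin u v\<close>: deleting \<open>v\<close>
  from \<open>Y\<close> leaves a subset of \<open>u\<close>, and \<open>v\<close> is adjoined again
  exactly when it belongs to \<open>Y\<close>.\<close>

lemma adj_nat_subset_closed: "HF X \<in> adj_nat n \<Longrightarrow> Y |\<subseteq>| X \<Longrightarrow> HF Y \<in> adj_nat n"
proof (induction n arbitrary: X Y)
  case 0
  then show ?case by (auto simp: hempty_def)
next
  case (Suc n)
  show ?case
  proof (cases "Y = {||}")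
    case True
    then show ?thesis by (simp add: hempty_def)
  next
    case False
    with Suc.prems obtain u v where uv: "HF X = adjoin u v" "u \<in> adj_nat n" "v \<in> adj_nat n"
      by (auto simp: hempty_def)
    then have X: "X = finsert v (elts u)" by (simp add: adjoin_def)
    have "Y |-| {|v|} |\<subseteq>| elts u" using X Suc.prems(2) by auto
    with uv(2) have *: "HF (Y |-| {|v|}) \<in> adj_nat n"
      using Suc.IH[of "elts u"] by simp
    show ?thesis
    proof (cases "v |\<in>| Y")
      case True
      then have "HF Y = adjoin (HF (Y |-| {|v|})) v" by (auto simp: adjoin_def)
      with * uv(3) show ?thesis by auto
    next
      case False
      with * adj_nat_Suc_subset show ?thesis by auto
    qed
  qed
qed

text \<open>The last hypothesis says that \<open>y\<close> has maximal level among the elements of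
  \<open>x\<close>. This permits an exchange: if the last adjoined \<open>w\<close> is not
  \<open>y\<close>, delete \<open>y\<close> from \<open>u\<close> by induction and adjoin
  \<open>w\<close> afterwards.\<close>

lemma adj_nat_remove_top:
  assumes "x \<in> adj_nat (Suc n)" "y |\<in>| elts x"
    and "\<And>z j. z |\<in>| elts x \<Longrightarrow> y \<in> adj_nat j \<Longrightarrow> z \<in> adj_nat j"
  shows "HF (elts x |-| {|y|}) \<in> adj_nat n"
  using assms
proof (induction n arbitrary: x)
  case 0
  from 0(1,2) have "elts x = {|y|}" by (auto simp: adjoin_def hempty_def)
  then show ?case by (simp add: hempty_def)
next
  case (Suc n)
  from Suc.prems(1,2) obtain u w
    where uw: "x = adjoin u w" "u \<in> adj_nat (Suc n)" "w \<in> adj_nat (Suc n)"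
    unfolding adj_nat.simps(2)[of "Suc n"] by (auto simp: hempty_def)
  have x: "elts x = finsert w (elts u)" using uw(1) by (simp add: adjoin_def)
  show ?case
  proof (cases "y = w")
    case True
    then have "elts x |-| {|y|} |\<subseteq>| elts u" using x by auto
    then show ?thesis using adj_nat_subset_closed[of "elts u" "Suc n"] uw(2)
      by (simp del: adj_nat.simps)
  next
    case False
    with Suc.prems(2) x have y: "y |\<in>| elts u" by auto
    have "HF (elts u |-| {|y|}) \<in> adj_nat n"
      by (rule Suc.IH[OF uw(2) y], rule Suc.prems(3)) (simp_all add: x)
    \<comment> \<open>\<open>w\<close> now has to be available one stage earlier. Since
      \<open>y\<close> is an element of \<open>u\<close>, it lies in \<open>adj_nat n\<close>, and
      maximality of \<open>y\<close> carries \<open>w\<close> there too.\<close>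
    moreover have "w \<in> adj_nat n"
      by (rule Suc.prems(3)[OF _ adj_nat_elts[OF uw(2) y]]) (simp add: x)
    moreover have "HF (elts x |-| {|y|}) = adjoin (HF (elts u |-| {|y|})) w"
      using x False by (auto simp: adjoin_def)
    ultimately show ?thesis by auto
  qed
qed

lemma adj_mono: "i \<le> j \<Longrightarrow> adj i \<subseteq> adj j"
proof -
  assume "i \<le> j"
  then have "adj_nat (nat i) \<subseteq> adj_nat (nat j)"
    using lift_Suc_mono_le[of adj_nat "nat i" "nat j"] adj_nat_Suc_subset nat_mono by blast
  with \<open>i \<le> j\<close> show ?thesis by (simp add: adj_def)
qed

lemma adj_succ: "0 \<le> n \<Longrightarrow> adj (n + 1) = adj_nat (Suc (nat n))"
  by (simp add: adj_def nat_add_distrib)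

lemma adj_elts: "x \<in> adj n \<Longrightarrow> fset (elts x) \<subseteq> adj (n - 1)"
proof -
  assume x: "x \<in> adj n"
  show ?thesis
  proof (cases "n \<le> 0")
    case True
    with x show ?thesis by (auto simp: adj_def hempty_def split: if_splits)
  next
    case False
    then have "adj n = adj_nat (Suc (nat (n - 1)))" "adj (n - 1) = adj_nat (nat (n - 1))"
      using adj_succ[of "n - 1"] by (simp_all add: adj_def)
    with x show ?thesis using adj_nat_elts by blast
  qed
qed

text \<open>The forward direction removes the top element \<open>y\<close> as if it had been
  adjoined last. For \<open>n \<le> 0\<close> both sides are false, as \<open>adj 0\<close> contains
  only \<open>hempty\<close> and \<open>adj (-1)\<close> is empty.\<close>

lemma finsert_in_adj_iff:
  assumes "y |\<notin>| X" and top: "\<And>z j. z |\<in>| X \<Longrightarrow> y \<in> adj j \<Longrightarrow> z \<in> adj j"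
  shows "HF (finsert y X) \<in> adj n \<longleftrightarrow> y \<in> adj (n - 1) \<and> HF X \<in> adj (n - 1)"
proof (cases "n \<le> 0")
  case True
  then show ?thesis by (auto simp: adj_def hempty_def)
next
  case False
  define k where "k = nat (n - 1)"
  have n: "adj n = adj_nat (Suc k)" "adj (n - 1) = adj_nat k"
    using False adj_succ[of "n - 1"] unfolding k_def by (simp_all add: adj_def)
  have top': "z \<in> adj_nat j" if "z |\<in>| X" "y \<in> adj_nat j" for z j
    using top[of z "int j"] that by (simp add: adj_def)
  have "y \<in> adj_nat k \<and> HF X \<in> adj_nat k" if "HF (finsert y X) \<in> adj_nat (Suc k)"
  proof -
    have "HF (elts (HF (finsert y X)) |-| {|y|}) \<in> adj_nat k"
      using that by (rule adj_nat_remove_top) (use top' in auto)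
    moreover have "finsert y X |-| {|y|} = X" using assms(1) by auto
    ultimately show ?thesis using adj_nat_elts[OF that, of y] by simp
  qed
  moreover have "HF (finsert y X) \<in> adj_nat (Suc k)" if "y \<in> adj_nat k" "HF X \<in> adj_nat k"
  proof -
    have "HF (finsert y X) = adjoin (HF X) y" by (simp add: adjoin_def)
    with that show ?thesis by auto
  qed
  ultimately show ?thesis unfolding n by blast
qed

text \<open>All elements of \<open>Z\<close> have level \<open>m\<close>, hence are top among what
  remains, so they can be stripped one by one, each lowering the index by one. The last one stripped
  gives the strongest bound on \<open>m\<close>; an empty \<open>Z\<close> gives none.\<close>

lemma funion_in_adj_iff:
  assumes "fset X \<subseteq> adj (m - 1)" and "fset Z \<subseteq> adj m - adj (m - 1)"
  shows "HF (X |\<union>| Z) \<in> adj n \<longleftrightarrow>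
    HF X \<in> adj (n - int (fcard Z)) \<and> (Z = {||} \<or> m \<le> n - int (fcard Z))"
  using assms(2)
proof (induction Z arbitrary: n)
  case empty
  then show ?case by (simp add: fcard_fempty)
next
  case (insert z Z)
  have z: "z \<in> adj j \<longleftrightarrow> m \<le> j" for j
    using insert.prems adj_mono[of m j] adj_mono[of j "m - 1"] by (cases "m \<le> j") auto
  have "u \<in> adj j" if u: "u |\<in>| X |\<union>| Z" and "z \<in> adj j" for u j
    using u assms(1) insert.prems adj_mono[of m j] adj_mono[of "m - 1" m] that(2) z by auto
  moreover have "z |\<notin>| X |\<union>| Z" using insert.hyps insert.prems assms(1) by auto
  ultimately have "HF (finsert z (X |\<union>| Z)) \<in> adj n \<longleftrightarrow>
      z \<in> adj (n - 1) \<and> HF (X |\<union>| Z) \<in> adj (n - 1)"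
    by (intro finsert_in_adj_iff) auto
  also have "\<dots> \<longleftrightarrow> m \<le> n - 1 \<and> HF X \<in> adj (n - 1 - int (fcard Z)) \<and>
      (Z = {||} \<or> m \<le> n - 1 - int (fcard Z))"
    using insert.IH[of "n - 1"] insert.prems z by auto
  also have "\<dots> \<longleftrightarrow> HF X \<in> adj (n - int (fcard (finsert z Z))) \<and>
      m \<le> n - int (fcard (finsert z Z))"
    using insert.hyps by (auto simp: fcard_finsert_disjoint fcard_fempty algebra_simps)
  finally show ?case by simp
qed

section \<open>Counting\<close>

text \<open>Subtracting over the integers covers \<open>t = 0\<close>: the bound on the elements is
  then negative, which forces \<open>x\<close> to be empty.\<close>

lemma rk_le_iff: "int (rk x) \<le> int t \<longleftrightarrow> (\<forall>y\<in>fset (elts x). int (rk y) \<le> int t - 1)"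
proof (cases "x = hempty")
  case True
  then show ?thesis by (simp add: hempty_def)
next
  case False
  then have "fset (elts x) \<noteq> {}" by (cases x) (auto simp: hempty_def)
  moreover have "finite (fset (elts x))" by simp
  ultimately have "Max (rk ` fset (elts x)) < t \<longleftrightarrow> (\<forall>y\<in>fset (elts x). rk y < t)"
    by (subst Max_less_iff) auto
  then show ?thesis using rk_nonempty[OF False] by auto
qed

text \<open>For second index \<open>n - 1\<close> the inclusion required by \<open>R\<close> is
  automatic, so these sets partition the sets of bounded rank by level.\<close>

lemma R_pred: "R t n (n - 1) = {x \<in> adj n - adj (n - 1). int (rk x) \<le> t}"
  using adj_elts by (auto simp: R_def)

lemma card_adj_rk:
  "card {x \<in> adj (int m). int (rk x) \<le> t} = (\<Sum>k = 0..m. r t (int k) (int k - 1))"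
proof (induction m)
  case 0
  have "adj (-1) = {}" by (simp add: adj_def)
  then show ?case using R_pred[of t 0] by (simp add: r_def)
next
  case (Suc m)
  have "{x \<in> adj (int (Suc m)). int (rk x) \<le> t} =
      {x \<in> adj (int m). int (rk x) \<le> t} \<union> R t (int (Suc m)) (int (Suc m) - 1)"
    unfolding R_pred using adj_mono[of "int m" "int (Suc m)"] by auto
  moreover have "{x \<in> adj (int m). int (rk x) \<le> t} \<inter> R t (int (Suc m)) (int (Suc m) - 1) = {}"
    unfolding R_pred by auto
  ultimately show ?case
    using finite_adj finite_R Suc.IH by (simp add: card_Un_disjoint r_def)
qed

text \<open>The rank bound splits elementwise over \<open>X\<close> and \<open>Z\<close>, and the
  level condition is \<open>funion_in_adj_iff\<close> at \<open>n\<close> and at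
  \<open>n - 1\<close>. The three cases match the three terms of the recurrence.\<close>

lemma funion_in_R_iff:
  assumes X: "fset X \<subseteq> adj (m - 1)" and Z: "fset Z \<subseteq> adj m - adj (m - 1)"
  shows "HF (X |\<union>| Z) \<in> R (int t) n m \<longleftrightarrow>
    fset Z \<subseteq> R (int t - 1) m (m - 1) \<and> int (rk (HF X)) \<le> int t \<and>
    (if Z = {||} then HF X \<in> adj n - adj (n - 1)
     else if m < n - int (fcard Z)
     then HF X \<in> adj (n - int (fcard Z)) - adj (n - int (fcard Z) - 1)
     else m = n - int (fcard Z) \<and> HF X \<in> adj m)"
proof -
  have "fset (X |\<union>| Z) \<subseteq> adj m" using X Z adj_mono[of "m - 1" m] by auto
  moreover have "int (rk (HF (X |\<union>| Z))) \<le> int t \<longleftrightarrow>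
      fset Z \<subseteq> R (int t - 1) m (m - 1) \<and> int (rk (HF X)) \<le> int t"
    unfolding rk_le_iff R_pred hf.sel union_fset using Z by blast
  moreover have "HF (X |\<union>| Z) \<in> adj n - adj (n - 1) \<longleftrightarrow>
    (if Z = {||} then HF X \<in> adj n - adj (n - 1)
     else if m < n - int (fcard Z)
     then HF X \<in> adj (n - int (fcard Z)) - adj (n - int (fcard Z) - 1)
     else m = n - int (fcard Z) \<and> HF X \<in> adj m)"
    (is "_ \<longleftrightarrow> ?rhs")
  proof (cases "Z = {||}")
    case True
    then show ?thesis by simp
  next
    case False
    have shift: "n - 1 - int (fcard Z) = n - int (fcard Z) - 1" by simp
    have "HF (X |\<union>| Z) \<in> adj n - adj (n - 1) \<longleftrightarrow>
        (HF X \<in> adj (n - int (fcard Z)) \<and> m \<le> n - int (fcard Z)) \<and>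
        \<not> (HF X \<in> adj (n - int (fcard Z) - 1) \<and> m \<le> n - int (fcard Z) - 1)"
      using False
      by (simp only: Diff_iff funion_in_adj_iff[OF X Z] shift simp_thms)
    \<comment> \<open>If \<open>m < n - int (fcard Z)\<close>, the bounds on \<open>m\<close> hold
      for both \<open>n\<close> and \<open>n - 1\<close>. At equality the one for
      \<open>n - 1\<close> fails, so only membership of \<open>HF X\<close> in \<open>adj m\<close>
      is left. Beyond that both fail.\<close>
    also have "\<dots> \<longleftrightarrow> ?rhs"
      using False by (cases "m < n - int (fcard Z)"; cases "m = n - int (fcard Z)") simp_all
    finally show ?thesis .
  qed
  moreover have "HF (X |\<union>| Z) \<in> R (int t) n m \<longleftrightarrow>
      HF (X |\<union>| Z) \<in> adj n - adj (n - 1) \<and> fset (X |\<union>| Z) \<subseteq> adj m \<and>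
      int (rk (HF (X |\<union>| Z))) \<le> int t"
    unfolding R_def[of "int t" n m] by simp
  ultimately show ?thesis by argo
qed

text \<open>The admissible lower parts \<open>X\<close> when \<open>k\<close> elements of level
  \<open>m\<close> are added. The second branch is meant for \<open>k = n - m\<close>, where the
  level of \<open>X\<close> may be anything up to \<open>m\<close>.\<close>

definition lower_parts :: "int \<Rightarrow> nat \<Rightarrow> nat \<Rightarrow> nat \<Rightarrow> hf set"
  where "lower_parts t n m k =
    (if k < n - m then R t (int n - int k) (int m - 1) else {x \<in> adj (int m). int (rk x) \<le> t})"

text \<open>Cutting \<open>x\<close> at \<open>adj (int m - 1)\<close> is a bijection onto triples
  \<open>(k, X, Z)\<close> with \<open>k\<close> the size of \<open>Z\<close>. For fixed
  \<open>k\<close> the choices of \<open>X\<close> and \<open>Z\<close> are independent, and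
  \<open>Z\<close> is any \<open>k\<close>-subset of the level-\<open>m\<close> sets of rank at most
  \<open>t - 1\<close>.\<close>

lemma card_R_eq_sum:
  assumes "m < n"
  shows "card (R (int t) (int n) (int m)) =
    (\<Sum>k = 0..n - m. card (lower_parts (int t) n m k)
                    * (card (R (int t - 1) (int m) (int m - 1)) choose k))"
proof -
  let ?L = "R (int t - 1) (int m) (int m - 1)"
  let ?A = "adj (int m - 1)"
  let ?D = "SIGMA k : {0..n - m}. lower_parts (int t) n m k \<times> {Z. Z \<subseteq> ?L \<and> card Z = k}"
  define split where "split x =
    (let Z = ffilter (\<lambda>y. y \<notin> ?A) (elts x) in (fcard Z, HF (ffilter (\<lambda>y. y \<in> ?A) (elts x)), fset Z))"
    for x
  define join where "join = (\<lambda>(k :: nat, X, Z). HF (elts X |\<union>| Abs_fset Z))"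
  have L: "?L \<subseteq> adj (int m) - ?A" by (auto simp: R_def)
  have lower: "fset (elts X) \<subseteq> ?A" if "X \<in> lower_parts (int t) n m k" for X k
    using that adj_elts[of X "int m"] by (auto simp: lower_parts_def R_def split: if_splits)
  have in_R: "HF (X |\<union>| Z) \<in> R (int t) (int n) (int m) \<longleftrightarrow>
      (fcard Z, HF X, fset Z) \<in> ?D"
    if X: "fset X \<subseteq> ?A" and Z: "fset Z \<subseteq> adj (int m) - ?A" for X Z
  proof -
    let ?c = "fcard Z"
    have lp: "HF X \<in> lower_parts (int t) n m k \<longleftrightarrow> int (rk (HF X)) \<le> int t \<and>
        (if k < n - m then HF X \<in> adj (int n - int k) - adj (int n - int k - 1)
         else HF X \<in> adj (int m))" for k
      using X by (simp add: lower_parts_def R_def conj_ac)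
    have "int (rk (HF X)) \<le> int t \<and>
        (if Z = {||} then HF X \<in> adj (int n) - adj (int n - 1)
         else if int m < int n - int ?c
         then HF X \<in> adj (int n - int ?c) - adj (int n - int ?c - 1)
         else int m = int n - int ?c \<and> HF X \<in> adj (int m)) \<longleftrightarrow>
        ?c \<le> n - m \<and> HF X \<in> lower_parts (int t) n m ?c"
    \<comment> \<open>An empty \<open>Z\<close> falls under the branch \<open>k < n - m\<close> of
      \<open>lower_parts\<close> with \<open>k = 0\<close>, because \<open>m < n\<close>.\<close>
    proof (cases "Z = {||}")
      case True
      then show ?thesis using assms unfolding lp by (simp add: fcard_fempty)
    next
      case False
      have "int m < int n - int ?c \<longleftrightarrow> ?c < n - m"
        and "int m = int n - int ?c \<longleftrightarrow> ?c = n - m"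
        and "?c \<le> n - m \<longleftrightarrow> ?c < n - m \<or> ?c = n - m"
        using assms by linarith+
      then show ?thesis
        using False unfolding lp by (simp only: if_False) argo
    qed
    moreover have "(?c, HF X, fset Z) \<in> ?D \<longleftrightarrow>
        (?c \<le> n - m \<and> HF X \<in> lower_parts (int t) n m ?c) \<and> fset Z \<subseteq> ?L"
      unfolding mem_Sigma_iff mem_Collect_eq atLeastAtMost_iff fcard.rep_eq by blast
    ultimately show ?thesis unfolding funion_in_R_iff[OF X Z] by argo
  qed
  have join_split: "join (split x) = x" for x
  proof -
    have "ffilter (\<lambda>y. y \<in> ?A) (elts x) |\<union>| ffilter (\<lambda>y. y \<notin> ?A) (elts x) = elts x" by auto
    then show ?thesis
      by (simp only: join_def split_def Let_def fset_inverse prod.case hf.sel hf.collapse)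
  qed
  have "bij_betw split (R (int t) (int n) (int m)) ?D"
  proof (rule bij_betw_byWitness[where f' = join])
    show "\<forall>x\<in>R (int t) (int n) (int m). join (split x) = x"
      using join_split by blast
    show "split ` R (int t) (int n) (int m) \<subseteq> ?D"
    proof
      fix p assume "p \<in> split ` R (int t) (int n) (int m)"
      then obtain x where x: "x \<in> R (int t) (int n) (int m)" and p: "p = split x" by auto
      define X Z where "X = ffilter (\<lambda>y. y \<in> ?A) (elts x)" and "Z = ffilter (\<lambda>y. y \<notin> ?A) (elts x)"
      have "X |\<union>| Z = elts x" by (auto simp: X_def Z_def)
      then have "HF (X |\<union>| Z) = x" by simp
      moreover have "fset X \<subseteq> ?A" "fset Z \<subseteq> adj (int m) - ?A"
        using x by (auto simp: X_def Z_def R_def)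
      ultimately have "(fcard Z, HF X, fset Z) \<in> ?D" using in_R[of X Z] x by metis
      then show "p \<in> ?D" by (simp only: p split_def Let_def X_def Z_def)
    qed
    have D: "split (join p) = p \<and> join p \<in> R (int t) (int n) (int m)" if p: "p \<in> ?D" for p
    proof -
      obtain k X' Z' where p': "p = (k, X', Z')" by (cases p)
      have Z': "Z' \<subseteq> ?L" "card Z' = k" and X': "X' \<in> lower_parts (int t) n m k"
        using p p' by auto
      \<comment> \<open>Finiteness makes \<open>Abs_fset\<close>, used in \<open>join\<close>, a
        true inverse of \<open>fset\<close> on \<open>Z'\<close>.\<close>
      have "finite Z'" using Z'(1) finite_R by (rule finite_subset)
      define X Z where "X = elts X'" and "Z = Abs_fset Z'"
      have fZ: "fset Z = Z'" using \<open>finite Z'\<close> by (simp add: Z_def Abs_fset_inverse)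
      have pXZ: "p = (fcard Z, HF X, fset Z)"
        using p' Z' fZ by (simp add: X_def fcard.rep_eq)
      have join: "join p = HF (X |\<union>| Z)" by (simp add: p' join_def X_def Z_def)
      have X: "fset X \<subseteq> ?A" using lower[OF X'] by (simp add: X_def)
      have Z: "fset Z \<subseteq> adj (int m) - ?A" using fZ Z' L by auto
      have "ffilter (\<lambda>y. y \<in> ?A) (X |\<union>| Z) = X" "ffilter (\<lambda>y. y \<notin> ?A) (X |\<union>| Z) = Z"
        using X Z by auto
      then have "split (join p) = p"
        unfolding join unfolding pXZ split_def Let_def hf.sel by (simp only:)
      moreover have "join p \<in> R (int t) (int n) (int m)"
        using p unfolding join in_R[OF X Z] pXZ[symmetric] .
      ultimately show ?thesis ..
    qed
    then show "\<forall>p\<in>?D. split (join p) = p" "join ` ?D \<subseteq> R (int t) (int n) (int m)"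
      by blast+
  qed
  then have "card (R (int t) (int n) (int m)) = card ?D" by (rule bij_betw_same_card)
  also have "\<dots> = (\<Sum>k = 0..n - m.
      card (lower_parts (int t) n m k \<times> {Z. Z \<subseteq> ?L \<and> card Z = k}))"
    using finite_R finite_adj by (intro card_SigmaI) (auto simp: lower_parts_def)
  finally show ?thesis
    by (simp add: card_cartesian_product n_subsets finite_R)
qed

theorem theorem3:
  fixes n m t :: nat
  assumes "m < n" and "t \<le> m + 1"
  shows "r (int t) (int n) (int m) =
      r (int t) (int n) (int m - 1)
    + (\<Sum>k = 1..n - m - 1. r (int t) (int n - int k) (int m - 1)
                          * (r (int t - 1) (int m) (int m - 1) choose k))
    + (r (int t - 1) (int m) (int m - 1) choose (n - m))
      * (\<Sum>k = 0..m. r (int t) (int k) (int k - 1))"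
proof -
  let ?f = "\<lambda>k. card (lower_parts (int t) n m k) * (r (int t - 1) (int m) (int m - 1) choose k)"
  \<comment> \<open>As \<open>n - m\<close> is positive, the indices \<open>0\<close> and
    \<open>n - m\<close> are distinct. The former yields the leading term, since a binomial
    coefficient over \<open>0\<close> is \<open>1\<close>; the latter yields the last term through
    \<open>card_adj_rk\<close>.\<close>
  obtain d where d: "n - m = Suc d" using assms(1) by (cases "n - m") auto
  have "r (int t) (int n) (int m) = sum ?f {0..Suc d}"
    using card_R_eq_sum[OF assms(1)] by (simp add: r_def d)
  also have "\<dots> = ?f 0 + sum ?f {1..d} + ?f (Suc d)"
    by (simp add: sum.atLeast_Suc_atMost)
  also have "sum ?f {1..d} = (\<Sum>k = 1..d. r (int t) (int n - int k) (int m - 1)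
                          * (r (int t - 1) (int m) (int m - 1) choose k))"
    by (intro sum.cong) (auto simp: lower_parts_def r_def d)
  finally show ?thesis
    using card_adj_rk[of m "int t"] by (simp add: lower_parts_def r_def d mult.commute)
qed

end
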